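(* Let $n\ge 2$, let $m_0$ and $d$ be positive integers with $\gcd(m_0,d)=1$, and let $m_i=m_0+id$ for $0\le i\le n$ be an arithmetic sequence with $\gcd(m_0,\ldots,m_n)=1$ that minimally generates the numerical semigroup $\sum_{i=0}^n\mathbb{N}_0 m_i$. Write $m_0=qn+r$ with integers $q,r$ and $1\le r\le n$. Let $F$ be a field and let $P\subseteq F[x_0,\ldots,x_n]$ be the defining ideal of the monomial curve corresponding to $m_0,\ldots,m_n$. Then the set $$\{x_ix_j-x_{i-1}x_{j+1}\mid 1\le i\le j\le n-1\}\cup\{x_{r+j}x_n^{q}-x_0^{q+d}x_j\mid 0\le j\le n-r\}$$ forms a Groebner basis for $P$ with respect to the grevlex monomial ordering with $x_0<x_1<\cdots<x_n$ and with the grading $wt(x_i)=m_i$.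
   Context: $P$ is the kernel of the $F$-algebra homomorphism $\eta:F[x_0,\ldots,x_n]\to F[t]$, $\eta(x_i)=t^{m_i}$. Here $\mathbb{N}_0=\mathbb{N}\cup\{0\}$. The monomial order is grevlex with the grading $wt(x_i)=m_i$ and $x_0<x_1<\cdots<x_n$: monomials are first compared by weighted degree, and for two monomials of equal weighted degree $\prod_{i=0}^n x_i^{a_i}>\prod_{i=0}^n x_i^{b_i}$ if the left-most nonzero entry of $(a_0-b_0,a_1-b_1,\ldots,a_n-b_n)$ is negative. *)

theory Defs
  imports "HOL-Library.Poly_Mapping" "HOL-Computational_Algebra.Polynomial" "HOL-Algebra.Ideal"
begin

section \<open>The polynomial ring in finitely many variables\<close>

text \<open>
  A monomial is its exponent vector \<open>nat \<Rightarrow>\<^sub>0 nat\<close>, and a polynomial maps monomials to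
  coefficients. Multiplication on \<open>(nat \<Rightarrow>\<^sub>0 nat) \<Rightarrow>\<^sub>0 'a\<close> is convolution. This type has countably
  many variables; \<open>F[x\<^sub>0,\<dots>,x\<^sub>n]\<close> is the subring of polynomials involving only the variables
  with index at most \<open>n\<close>. Ideals have to be formed in this subring.
\<close>

type_synonym monomial = "nat \<Rightarrow>\<^sub>0 nat"
type_synonym 'a mpoly = "monomial \<Rightarrow>\<^sub>0 'a"

definition Var :: "nat \<Rightarrow> 'a::comm_ring_1 mpoly" where
  "Var i = Poly_Mapping.single (Poly_Mapping.single i 1) 1"

definition mpoly_ring :: "nat \<Rightarrow> 'a::comm_ring_1 mpoly ring" where
  "mpoly_ring n =
     \<lparr>carrier = {f. \<forall>a \<in> Poly_Mapping.keys f. Poly_Mapping.keys a \<subseteq> {..n}},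
      mult = (*), one = 1, zero = 0, add = (+)\<rparr>"

text \<open>\<^const>\<open>genideal\<close> would be vacuous over a structure that is not a ring, hence the following.\<close>

lemma cring_mpoly_ring: "cring (mpoly_ring n :: 'a::comm_ring_1 mpoly ring)"
proof (rule cringI)
  have add: "f + g \<in> carrier (mpoly_ring n)"
    if "f \<in> carrier (mpoly_ring n)" "g \<in> carrier (mpoly_ring n)" for f g :: "'a mpoly"
    using that Poly_Mapping.keys_add[of f g] by (auto simp: mpoly_ring_def)
  have mult: "f * g \<in> carrier (mpoly_ring n)"
    if "f \<in> carrier (mpoly_ring n)" "g \<in> carrier (mpoly_ring n)" for f g :: "'a mpoly"
  proof -
    have "Poly_Mapping.keys c \<subseteq> {..n}" if "c \<in> Poly_Mapping.keys (f * g)" for c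
    proof -
      obtain a b where "c = a + b" "a \<in> Poly_Mapping.keys f" "b \<in> Poly_Mapping.keys g"
        using Poly_Mapping.keys_mult[of f g] \<open>c \<in> Poly_Mapping.keys (f * g)\<close> by blast
      with Poly_Mapping.keys_add[of a b] \<open>f \<in> carrier _\<close> \<open>g \<in> carrier _\<close>
      show ?thesis by (auto simp: mpoly_ring_def)
    qed
    then show ?thesis by (simp add: mpoly_ring_def)
  qed
  have uminus: "- f \<in> carrier (mpoly_ring n)"
    if "f \<in> carrier (mpoly_ring n)" for f :: "'a mpoly"
    using that by (auto simp: mpoly_ring_def in_keys_iff)
  have zero: "(0 :: 'a mpoly) \<in> carrier (mpoly_ring n)"
    and one: "(1 :: 'a mpoly) \<in> carrier (mpoly_ring n)"
    by (simp_all add: mpoly_ring_def)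
  have ops: "f \<oplus>\<^bsub>mpoly_ring n\<^esub> g = f + g" "f \<otimes>\<^bsub>mpoly_ring n\<^esub> g = f * g"
    "\<zero>\<^bsub>mpoly_ring n\<^esub> = (0 :: 'a mpoly)" "\<one>\<^bsub>mpoly_ring n\<^esub> = (1 :: 'a mpoly)" for f g :: "'a mpoly"
    by (simp_all add: mpoly_ring_def)
  show "abelian_group (mpoly_ring n :: 'a mpoly ring)"
  proof (rule abelian_groupI, unfold ops)
    fix f :: "'a mpoly" assume "f \<in> carrier (mpoly_ring n)"
    then show "\<exists>g \<in> carrier (mpoly_ring n). g + f = 0"
      using uminus[of f] by (intro bexI[of _ "- f"]) simp_all
  qed (simp_all add: add zero add_ac)
  show "Group.comm_monoid (mpoly_ring n :: 'a mpoly ring)"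
    by (rule comm_monoidI, unfold ops) (simp_all add: mult one mult_ac)
  show "(f \<oplus>\<^bsub>mpoly_ring n\<^esub> g) \<otimes>\<^bsub>mpoly_ring n\<^esub> h =
      f \<otimes>\<^bsub>mpoly_ring n\<^esub> h \<oplus>\<^bsub>mpoly_ring n\<^esub> g \<otimes>\<^bsub>mpoly_ring n\<^esub> h" for f g h :: "'a mpoly"
    unfolding ops by (rule distrib_right)
qed


section \<open>Monomial orders, leading terms and Groebner bases\<close>

definition weight :: "(nat \<Rightarrow> nat) \<Rightarrow> monomial \<Rightarrow> nat" where
  "weight w a = (\<Sum>i \<in> Poly_Mapping.keys a. Poly_Mapping.lookup a i * w i)"

text \<open>
  The grevlex order with \<open>x\<^sub>0 < x\<^sub>1 < \<dots>\<close> and \<open>wt(x\<^sub>i) = w i\<close>. In equal weight, \<open>a < b\<close> means that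
  the left-most nonzero entry of \<open>b - a\<close> is negative.
\<close>

definition grevlex_less :: "(nat \<Rightarrow> nat) \<Rightarrow> monomial \<Rightarrow> monomial \<Rightarrow> bool" where
  "grevlex_less w a b \<longleftrightarrow>
     weight w a < weight w b \<or>
     weight w a = weight w b \<and>
       (\<exists>i. Poly_Mapping.lookup b i < Poly_Mapping.lookup a i \<and>
          (\<forall>j<i. Poly_Mapping.lookup b j = Poly_Mapping.lookup a j))"

text \<open>The parameter \<open>lt\<close> below is the strict part of a total order on monomials.\<close>

definition lead_monomial :: "(monomial \<Rightarrow> monomial \<Rightarrow> bool) \<Rightarrow> 'a::comm_ring_1 mpoly \<Rightarrow> monomial" where
  "lead_monomial lt f =
     (THE a. a \<in> Poly_Mapping.keys f \<and> (\<forall>b \<in> Poly_Mapping.keys f. b \<noteq> a \<longrightarrow> lt b a))"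

definition lead_term :: "(monomial \<Rightarrow> monomial \<Rightarrow> bool) \<Rightarrow> 'a::comm_ring_1 mpoly \<Rightarrow> 'a mpoly" where
  "lead_term lt f =
     Poly_Mapping.single (lead_monomial lt f) (Poly_Mapping.lookup f (lead_monomial lt f))"

definition lead_ideal ::
    "nat \<Rightarrow> (monomial \<Rightarrow> monomial \<Rightarrow> bool) \<Rightarrow> 'a::comm_ring_1 mpoly set \<Rightarrow> 'a mpoly set" where
  "lead_ideal n lt S = genideal (mpoly_ring n) (lead_term lt ` (S - {0}))"

definition groebner_basis ::
    "nat \<Rightarrow> (monomial \<Rightarrow> monomial \<Rightarrow> bool) \<Rightarrow> 'a::comm_ring_1 mpoly set \<Rightarrow> 'a mpoly set \<Rightarrow> bool" where
  "groebner_basis n lt G I \<longleftrightarrow>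
     ideal I (mpoly_ring n) \<and> finite G \<and> G \<subseteq> I \<and> lead_ideal n lt G = lead_ideal n lt I"

lemma grevlex_less_irrefl: "\<not> grevlex_less w a a"
  by (auto simp: grevlex_less_def)

lemma grevlex_less_trans:
  assumes "grevlex_less w a b" "grevlex_less w b c"
  shows "grevlex_less w a c"
proof -
  have "\<exists>i. f i < h i \<and> (\<forall>j<i. f j = h j)"
    if "g i < h i" "\<forall>j<i. g j = h j" "f k < g k" "\<forall>j<k. f j = g j"
    for i k and f g h :: "nat \<Rightarrow> nat"
  proof (cases i k rule: linorder_cases)
    case less
    with that show ?thesis by (intro exI[of _ i]) simp
  next
    case equal
    with that have "f i < h i \<and> (\<forall>j<i. f j = h j)" by simp
    then show ?thesis ..
  next
    case greater
    with that show ?thesis by (intro exI[of _ k]) simp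
  qed
  note lex = this
  from assms show ?thesis
    unfolding grevlex_less_def by (elim disjE conjE exE) (simp_all add: lex)
qed

lemma grevlex_less_total:
  assumes "a \<noteq> b"
  shows "grevlex_less w a b \<or> grevlex_less w b a"
proof -
  define i where "i = (LEAST i. Poly_Mapping.lookup a i \<noteq> Poly_Mapping.lookup b i)"
  have "\<exists>i. Poly_Mapping.lookup a i \<noteq> Poly_Mapping.lookup b i" using assms by (metis poly_mapping_eqI)
  then have "Poly_Mapping.lookup a i \<noteq> Poly_Mapping.lookup b i" unfolding i_def by (rule LeastI_ex)
  moreover have "\<forall>j<i. Poly_Mapping.lookup a j = Poly_Mapping.lookup b j" unfolding i_def using not_less_Least by blast
  ultimately show ?thesis unfolding grevlex_less_def by (metis linorder_neqE_nat)
qed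

lemma lead_monomial_grevlex:
  fixes f :: "'a::comm_ring_1 mpoly"
  assumes "f \<noteq> 0"
  shows "lead_monomial (grevlex_less w) f \<in> Poly_Mapping.keys f"
    and "\<And>b. b \<in> Poly_Mapping.keys f \<Longrightarrow> b \<noteq> lead_monomial (grevlex_less w) f \<Longrightarrow>
           grevlex_less w b (lead_monomial (grevlex_less w) f)"
proof -
  have ex: "\<exists>a\<in>A. \<forall>b\<in>A. b \<noteq> a \<longrightarrow> grevlex_less w b a" if "finite A" "A \<noteq> {}" for A
    using that
  proof (induction rule: finite_ne_induct)
    case (insert x A)
    then obtain a where a: "a \<in> A" "\<forall>b\<in>A. b \<noteq> a \<longrightarrow> grevlex_less w b a" by blast
    with insert.hyps grevlex_less_total[of x a w] consider "grevlex_less w x a" | "grevlex_less w a x"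
      by blast
    then show ?case
    proof cases
      case 1
      with a show ?thesis by (intro bexI[of _ a]) auto
    next
      case 2
      with a show ?thesis by (intro bexI[of _ x]) (auto dest: grevlex_less_trans)
    qed
  qed auto
  have "Poly_Mapping.keys f \<noteq> {}" using assms by simp
  from ex[OF finite_keys this] obtain a where
    a: "a \<in> Poly_Mapping.keys f" "\<forall>b\<in>Poly_Mapping.keys f. b \<noteq> a \<longrightarrow> grevlex_less w b a" by blast
  have "lead_monomial (grevlex_less w) f = a"
    unfolding lead_monomial_def
  proof (rule the_equality)
    fix c
    assume c: "c \<in> Poly_Mapping.keys f \<and> (\<forall>b\<in>Poly_Mapping.keys f. b \<noteq> c \<longrightarrow> grevlex_less w b c)"
    show "c = a"
    proof (rule ccontr)
      assume "c \<noteq> a"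
      with a c have "grevlex_less w a c" "grevlex_less w c a" by auto
      then show False using grevlex_less_trans grevlex_less_irrefl by metis
    qed
  qed (use a in simp)
  with a show "lead_monomial (grevlex_less w) f \<in> Poly_Mapping.keys f"
    and "\<And>b. b \<in> Poly_Mapping.keys f \<Longrightarrow> b \<noteq> lead_monomial (grevlex_less w) f \<Longrightarrow>
           grevlex_less w b (lead_monomial (grevlex_less w) f)" by auto
qed


section \<open>Monomial curves and numerical semigroups\<close>

text \<open>The \<open>F\<close>-algebra homomorphism \<open>F[x\<^sub>0,x\<^sub>1,\<dots>] \<rightarrow> F[t]\<close> with \<open>x\<^sub>i \<mapsto> t\<^bsup>m i\<^esup>\<close>.\<close>

definition curve_hom :: "(nat \<Rightarrow> nat) \<Rightarrow> 'a::comm_ring_1 mpoly \<Rightarrow> 'a poly" where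
  "curve_hom m f =
     (\<Sum>a \<in> Poly_Mapping.keys f.
        Polynomial.smult (Poly_Mapping.lookup f a)
          (\<Prod>i \<in> Poly_Mapping.keys a. Polynomial.monom 1 (m i) ^ Poly_Mapping.lookup a i))"

definition curve_ideal :: "nat \<Rightarrow> (nat \<Rightarrow> nat) \<Rightarrow> 'a::comm_ring_1 mpoly set" where
  "curve_ideal n m = {f \<in> carrier (mpoly_ring n). curve_hom m f = 0}"

definition semigroup_gen :: "nat set \<Rightarrow> (nat \<Rightarrow> nat) \<Rightarrow> nat set" where
  "semigroup_gen A m = {\<Sum>i\<in>A. c i * m i | c :: nat \<Rightarrow> nat. True}"

definition minimally_generates :: "nat \<Rightarrow> (nat \<Rightarrow> nat) \<Rightarrow> bool" where
  "minimally_generates n m \<longleftrightarrow>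
     (\<forall>A. A \<subset> {..n} \<longrightarrow> semigroup_gen A m \<noteq> semigroup_gen {..n} m)"

lemma curve_hom_single:
  "curve_hom m (Poly_Mapping.single a c :: 'a::comm_ring_1 mpoly) = Polynomial.monom c (weight m a)"
proof -
  have "(\<Prod>i \<in> Poly_Mapping.keys a. Polynomial.monom (1::'a) (m i) ^ Poly_Mapping.lookup a i)
          = Polynomial.monom 1 (weight m a)"
  proof -
    have "(\<Prod>i\<in>K. Polynomial.monom (1::'a) (m i) ^ Poly_Mapping.lookup a i)
            = Polynomial.monom 1 (\<Sum>i\<in>K. Poly_Mapping.lookup a i * m i)" if "finite K" for K
      using that by induction (simp_all add: monom_power mult_monom mult.commute)
    then show ?thesis by (simp add: weight_def)
  qed
  then show ?thesis
    by (cases "c = 0") (auto simp: curve_hom_def smult_monom)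
qed

lemma curve_hom_Var: "curve_hom m (Var i) = Polynomial.monom 1 (m i)"
  by (simp add: Var_def curve_hom_single weight_def)

lemma curve_hom_const: "curve_hom m (Poly_Mapping.single 0 c) = [:c:]"
  by (simp add: curve_hom_single weight_def monom_0)

lemma curve_hom_add: "curve_hom m (f + g) = curve_hom m f + curve_hom m g"
proof -
  let ?K = "Poly_Mapping.keys f \<union> Poly_Mapping.keys g"
  have "curve_hom m h =
      (\<Sum>a \<in> ?K. Polynomial.smult (Poly_Mapping.lookup h a)
          (\<Prod>i \<in> Poly_Mapping.keys a. Polynomial.monom 1 (m i) ^ Poly_Mapping.lookup a i))"
    if "Poly_Mapping.keys h \<subseteq> ?K" for h
    unfolding curve_hom_def using that
    by (intro sum.mono_neutral_left) (auto simp: in_keys_iff)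
  from this[of f] this[of g] this[of "f + g"] show ?thesis
    using Poly_Mapping.keys_add[of f g] by (simp add: lookup_add smult_add_left sum.distrib)
qed

lemma curve_hom_mult: "curve_hom m (f * g) = curve_hom m f * curve_hom m g"
proof -
  have sum: "curve_hom m (sum h K) = (\<Sum>k\<in>K. curve_hom m (h k))" if "finite K"
    for h :: "'i \<Rightarrow> 'a mpoly" and K
    using that by induction (simp_all add: curve_hom_add, simp add: curve_hom_def)
  have expand: "f = (\<Sum>a\<in>Poly_Mapping.keys f. Poly_Mapping.single a (Poly_Mapping.lookup f a))" for f :: "'a mpoly"
    by (rule poly_mapping_eqI)
       (auto simp: lookup_sum lookup_single when_def in_keys_iff sum.delta')
  have weight_add: "weight m (a + b) = weight m a + weight m b" for a b
  proof -
    let ?K = "Poly_Mapping.keys a \<union> Poly_Mapping.keys b"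
    have "weight m c = (\<Sum>i\<in>?K. Poly_Mapping.lookup c i * m i)" if "Poly_Mapping.keys c \<subseteq> ?K" for c
      unfolding weight_def using that
      by (intro sum.mono_neutral_left) (auto simp: in_keys_iff)
    then show ?thesis
      using Poly_Mapping.keys_add[of a b] by (simp add: lookup_add algebra_simps sum.distrib)
  qed
  have single: "curve_hom m (Poly_Mapping.single a c * g)
      = curve_hom m (Poly_Mapping.single a c) * curve_hom m g" for a and c :: 'a and g
    by (subst (1 2) expand[of g])
       (simp add: sum_distrib_left sum mult_single curve_hom_single weight_add mult_monom)
  show ?thesis
    by (subst (1 2) expand[of f]) (simp add: sum_distrib_right sum single)
qed

end

theory Submission
  imports Defs "HOL-Number_Theory.Cong"
begin

text \<open>
  Everything rests on the standard monomials, those divisible by no leading monomial of the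
  listed binomials. The leading monomials are \<open>x\<^sub>i x\<^sub>j\<close> with \<open>1 \<le> i \<le> j \<le> n - 1\<close> and
  \<open>x\<^bsub>r+j\<^esub> x\<^sub>n\<^sup>q\<close>, because the other term always has the larger exponent at the first variable
  where the two differ. So a standard monomial is \<open>x\<^sub>0\<^sup>a x\<^sub>i x\<^sub>n\<^sup>b\<close> with \<open>0 \<le> i < n\<close> (for \<open>i = 0\<close>
  the middle factor is absent), and the second family says exactly that \<open>i + b n < q n + r = m\<^sub>0\<close>.
  Its weight is congruent to \<open>d (i + b n)\<close> modulo \<open>m\<^sub>0\<close>. As \<open>d\<close> is a unit modulo \<open>m\<^sub>0\<close>, the weight
  determines \<open>i + b n\<close>, hence \<open>i\<close> and \<open>b\<close>, and then \<open>a\<close>: distinct standard monomials have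
  distinct weights (\<open>standard_monomial_shape\<close>, \<open>normal_form_weight_inj\<close>).

  This property alone yields a Groebner basis (\<open>binomial_groebner_basis\<close>). Replacing the leading monomial of a binomial by its other monomial lowers a
  monomial and keeps its weight, so the least monomial of each weight is standard, and by
  uniqueness it is the only standard one. Let \<open>f\<close> be a nonzero element of the curve ideal. Its
  coefficients of any given weight sum to zero, so the leading monomial of \<open>f\<close> is not the least of
  its weight. Therefore it is not standard, which means that a leading term of a binomial divides it.
\<close>

section \<open>Monomials and their weights\<close>

lemma weight_eq_sum:
  assumes "finite K" "Poly_Mapping.keys a \<subseteq> K"
  shows "weight w a = (\<Sum>i\<in>K. Poly_Mapping.lookup a i * w i)"
  unfolding weight_def using assms
  by (intro sum.mono_neutral_left) (auto simp: in_keys_iff)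

lemma weight_add: "weight w (a + b) = weight w a + weight w b"
proof -
  let ?K = "Poly_Mapping.keys a \<union> Poly_Mapping.keys b"
  have "weight w c = (\<Sum>i\<in>?K. Poly_Mapping.lookup c i * w i)" if "Poly_Mapping.keys c \<subseteq> ?K" for c
    using that by (intro weight_eq_sum) auto
  then show ?thesis
    using Poly_Mapping.keys_add[of a b] by (simp add: lookup_add algebra_simps sum.distrib)
qed

lemma weight_single [simp]: "weight w (Poly_Mapping.single i e) = e * w i"
  by (simp add: weight_def)

lemma keys_add_nat:
  fixes a b :: monomial
  shows "Poly_Mapping.keys (a + b) = Poly_Mapping.keys a \<union> Poly_Mapping.keys b"
  by (auto simp: in_keys_iff lookup_add)

lemma grevlex_less_add_left:
  assumes "grevlex_less w a b"
  shows "grevlex_less w (c + a) (c + b)"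
  using assms by (auto simp: grevlex_less_def weight_add lookup_add)

lemma monomial_divides_iff:
  fixes a u :: monomial
  shows "(\<exists>c. u = c + a) \<longleftrightarrow> (\<forall>i. Poly_Mapping.lookup a i \<le> Poly_Mapping.lookup u i)"
proof
  assume "\<forall>i. Poly_Mapping.lookup a i \<le> Poly_Mapping.lookup u i"
  then have "u = (u - a) + a"
    by (intro poly_mapping_eqI) (simp add: lookup_add lookup_minus)
  then show "\<exists>c. u = c + a" ..
qed (auto simp: lookup_add)

lemma finite_monomials_of_weight:
  assumes "\<And>i. i \<le> n \<Longrightarrow> w i > 0"
  shows "finite {a. Poly_Mapping.keys a \<subseteq> {..n} \<and> weight w a = k}"
proof -
  let ?A = "{a. Poly_Mapping.keys a \<subseteq> {..n} \<and> weight w a = k}"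
  have "Poly_Mapping.lookup a i \<le> k" if "a \<in> ?A" "i \<le> n" for a i
  proof -
    have "Poly_Mapping.lookup a i \<le> Poly_Mapping.lookup a i * w i"
      using assms[OF \<open>i \<le> n\<close>] by simp
    also have "\<dots> \<le> (\<Sum>i\<le>n. Poly_Mapping.lookup a i * w i)"
      using \<open>i \<le> n\<close> by (intro member_le_sum) auto
    also have "\<dots> = k"
      using that weight_eq_sum[of "{..n}" a] by simp
    finally show ?thesis .
  qed
  then have "Poly_Mapping.lookup ` ?A \<subseteq>
      {f. \<forall>i. (i \<in> {..n} \<longrightarrow> f i \<in> {..k}) \<and> (i \<notin> {..n} \<longrightarrow> f i = 0)}"
    by (auto simp: in_keys_iff)
  moreover have "finite {f. \<forall>i. (i \<in> {..n} \<longrightarrow> f i \<in> {..k}) \<and> (i \<notin> {..n} \<longrightarrow> f i = (0::nat))}"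
    by (rule finite_set_of_finite_funs) simp_all
  ultimately have "finite (Poly_Mapping.lookup ` ?A)"
    by (rule finite_subset)
  then show ?thesis
    by (rule finite_imageD) (simp add: inj_on_def)
qed

section \<open>Binomials and the curve ideal\<close>

definition binomial :: "monomial \<Rightarrow> monomial \<Rightarrow> 'a::comm_ring_1 mpoly" where
  "binomial a b = Poly_Mapping.single a 1 - Poly_Mapping.single b 1"

lemma Var_power: "(Var i :: 'a::comm_ring_1 mpoly) ^ e = Poly_Mapping.single (Poly_Mapping.single i e) 1"
  by (induction e) (simp_all add: Var_def mult_single flip: single_add)

lemma keys_binomial:
  assumes "a \<noteq> b"
  shows "Poly_Mapping.keys (binomial a b :: 'a::comm_ring_1 mpoly) = {a, b}"
  using assms by (auto simp: binomial_def in_keys_iff lookup_minus lookup_single when_def split: if_splits)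

lemma binomial_nonzero:
  assumes "a \<noteq> b"
  shows "(binomial a b :: 'a::comm_ring_1 mpoly) \<noteq> 0"
  using keys_binomial[OF assms, where 'a='a] by auto

lemma lead_term_binomial:
  assumes "grevlex_less w b a"
  shows "lead_term (grevlex_less w) (binomial a b :: 'a::comm_ring_1 mpoly) = Poly_Mapping.single a 1"
proof -
  let ?f = "binomial a b :: 'a mpoly"
  have "a \<noteq> b" using assms grevlex_less_irrefl by metis
  note keys = keys_binomial[OF this, where 'a='a] and nz = binomial_nonzero[OF this, where 'a='a]
  have "lead_monomial (grevlex_less w) ?f = a"
  proof (rule ccontr)
    assume "lead_monomial (grevlex_less w) ?f \<noteq> a"
    then have "lead_monomial (grevlex_less w) ?f = b" "grevlex_less w a b"
      using lead_monomial_grevlex[OF nz, where w = w] keys by auto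
    then show False using assms grevlex_less_trans grevlex_less_irrefl by metis
  qed
  then show ?thesis
    using \<open>a \<noteq> b\<close> by (simp add: lead_term_def binomial_def lookup_minus lookup_single when_def)
qed

lemma single_in_mpoly_ring:
  "Poly_Mapping.keys a \<subseteq> {..n} \<Longrightarrow> Poly_Mapping.single a c \<in> carrier (mpoly_ring n)"
  by (auto simp: mpoly_ring_def)

lemma curve_hom_eq_sum:
  "curve_hom w f = (\<Sum>a\<in>Poly_Mapping.keys f. Polynomial.monom (Poly_Mapping.lookup f a) (weight w a))"
proof -
  have "(\<Prod>i\<in>Poly_Mapping.keys a. Polynomial.monom (1::'a) (w i) ^ Poly_Mapping.lookup a i)
      = Polynomial.monom 1 (weight w a)" for a
    using curve_hom_single[of w a "1::'a"] by (simp add: curve_hom_def)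
  then show ?thesis by (simp add: curve_hom_def smult_monom)
qed

lemma coeff_curve_hom:
  "Polynomial.coeff (curve_hom w f) k =
     (\<Sum>a | a \<in> Poly_Mapping.keys f \<and> weight w a = k. Poly_Mapping.lookup f a)"
  by (simp add: curve_hom_eq_sum coeff_sum coeff_monom if_distrib sum.If_cases Int_def cong: if_cong)

lemma curve_hom_uminus: "curve_hom w (- f) = - curve_hom w f"
  by (simp add: curve_hom_eq_sum sum_negf flip: minus_monom)

lemma ideal_curve_ideal: "ideal (curve_ideal n w :: 'a::comm_ring_1 mpoly set) (mpoly_ring n)"
proof -
  interpret R: cring "mpoly_ring n :: 'a mpoly ring" by (rule cring_mpoly_ring)
  have ops: "f \<oplus>\<^bsub>mpoly_ring n\<^esub> g = f + g" "f \<otimes>\<^bsub>mpoly_ring n\<^esub> g = f * g"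
    "\<zero>\<^bsub>mpoly_ring n\<^esub> = (0 :: 'a mpoly)" for f g :: "'a mpoly"
    by (simp_all add: mpoly_ring_def)
  have inv: "\<ominus>\<^bsub>mpoly_ring n\<^esub> f = - f" if "f \<in> carrier (mpoly_ring n)" for f :: "'a mpoly"
    using that R.l_neg[OF that] by (simp add: ops eq_neg_iff_add_eq_0)
  show ?thesis
  proof (rule idealI)
    show "ring (mpoly_ring n :: 'a mpoly ring)" by unfold_locales
    show "subgroup (curve_ideal n w) (add_monoid (mpoly_ring n :: 'a mpoly ring))"
    proof (rule R.add.subgroupI)
      have "(0 :: 'a mpoly) \<in> curve_ideal n w"
        using R.zero_closed by (simp add: curve_ideal_def ops curve_hom_def)
      then show "(curve_ideal n w :: 'a mpoly set) \<noteq> {}" by blast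
    next
      fix f :: "'a mpoly" assume "f \<in> curve_ideal n w"
      then show "\<ominus>\<^bsub>mpoly_ring n\<^esub> f \<in> curve_ideal n w"
        using R.a_inv_closed[of f] by (simp add: curve_ideal_def inv curve_hom_uminus)
    next
      fix f g :: "'a mpoly" assume "f \<in> curve_ideal n w" "g \<in> curve_ideal n w"
      then show "f \<oplus>\<^bsub>mpoly_ring n\<^esub> g \<in> curve_ideal n w"
        using R.a_closed[of f g] by (simp add: curve_ideal_def ops curve_hom_add)
    qed (simp add: curve_ideal_def)
  next
    fix f x :: "'a mpoly" assume "f \<in> curve_ideal n w" "x \<in> carrier (mpoly_ring n)"
    then show "x \<otimes>\<^bsub>mpoly_ring n\<^esub> f \<in> curve_ideal n w"
      using R.m_closed[of x f] by (simp add: curve_ideal_def ops curve_hom_mult)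
  next
    fix f x :: "'a mpoly" assume "f \<in> curve_ideal n w" "x \<in> carrier (mpoly_ring n)"
    then show "f \<otimes>\<^bsub>mpoly_ring n\<^esub> x \<in> curve_ideal n w"
      using R.m_closed[of f x] by (simp add: curve_ideal_def ops curve_hom_mult)
  qed
qed

lemma binomial_in_curve_ideal:
  assumes "Poly_Mapping.keys a \<subseteq> {..n}" "Poly_Mapping.keys b \<subseteq> {..n}" "weight w a = weight w b"
  shows "(binomial a b :: 'a::comm_ring_1 mpoly) \<in> curve_ideal n w"
proof (cases "a = b")
  case True
  then show ?thesis by (simp add: binomial_def curve_ideal_def mpoly_ring_def curve_hom_def)
next
  case False
  have "curve_hom w (binomial a b :: 'a mpoly)
      = curve_hom w (Poly_Mapping.single a 1) - curve_hom w (Poly_Mapping.single b 1)"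
    using curve_hom_add[of w "Poly_Mapping.single a 1" "- Poly_Mapping.single b (1::'a)"]
    by (simp add: binomial_def curve_hom_uminus)
  then show ?thesis
    using assms keys_binomial[OF False, where 'a='a]
    by (simp add: curve_ideal_def mpoly_ring_def curve_hom_single)
qed

text \<open>
  The coefficients of \<open>f\<close> at the weight of its leading monomial sum to zero, so the leading
  coefficient has to be cancelled by another monomial of that weight.
\<close>

lemma curve_ideal_lead_monomial_not_least:
  assumes "f \<in> curve_ideal n w" "f \<noteq> 0"
  obtains v where "Poly_Mapping.keys v \<subseteq> {..n}" "weight w v = weight w (lead_monomial (grevlex_less w) f)"
    "grevlex_less w v (lead_monomial (grevlex_less w) f)"
proof -
  define u where "u = lead_monomial (grevlex_less w) f"
  define K where "K = {a \<in> Poly_Mapping.keys f. weight w a = weight w u}"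
  have u: "u \<in> Poly_Mapping.keys f"
    using lead_monomial_grevlex(1)[OF \<open>f \<noteq> 0\<close>] by (simp add: u_def)
  have "sum (Poly_Mapping.lookup f) K = 0"
    using coeff_curve_hom[of w f "weight w u"] assms by (simp add: K_def curve_ideal_def)
  moreover have "Poly_Mapping.lookup f u \<noteq> 0"
    using u by (simp add: in_keys_iff)
  ultimately have "K \<noteq> {u}" by auto
  then obtain v where "v \<in> K" "v \<noteq> u"
    using u by (auto simp: K_def)
  then have "v \<in> Poly_Mapping.keys f" "weight w v = weight w u" by (auto simp: K_def)
  then show ?thesis
    using that[of v] \<open>v \<noteq> u\<close> assms lead_monomial_grevlex(2)[OF \<open>f \<noteq> 0\<close>, of v w]
    by (auto simp: u_def curve_ideal_def mpoly_ring_def)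
qed

section \<open>A Groebner basis criterion for binomials\<close>

definition standard_monomial :: "(monomial \<times> monomial) set \<Rightarrow> monomial \<Rightarrow> bool" where
  "standard_monomial R u \<longleftrightarrow> (\<forall>(a, b)\<in>R. \<nexists>c. u = c + a)"

text \<open>
  A pair \<open>(a, b)\<close> in \<open>R\<close> allows \<open>c + a\<close> to be replaced by the smaller monomial \<open>c + b\<close> of the same
  weight. The least monomial of a weight admits no replacement, so it is standard; if there is
  only one standard monomial of that weight, it is the least one.
\<close>

lemma standard_monomial_least:
  assumes pos: "\<And>i. i \<le> n \<Longrightarrow> w i > 0"
    and R: "\<And>a b. (a, b) \<in> R \<Longrightarrow> Poly_Mapping.keys b \<subseteq> {..n} \<and> weight w a = weight w b \<and> grevlex_less w b a"
    and inj: "\<And>u v. standard_monomial R u \<Longrightarrow> standard_monomial R v \<Longrightarrow> Poly_Mapping.keys u \<subseteq> {..n} \<Longrightarrow>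
      Poly_Mapping.keys v \<subseteq> {..n} \<Longrightarrow> weight w u = weight w v \<Longrightarrow> u = v"
    and u: "standard_monomial R u" "Poly_Mapping.keys u \<subseteq> {..n}"
    and v: "Poly_Mapping.keys v \<subseteq> {..n}" "weight w v = weight w u"
  shows "\<not> grevlex_less w v u"
proof -
  let ?A = "{a. Poly_Mapping.keys a \<subseteq> {..n} \<and> weight w a = weight w u}"
  have "asymp_on ?A (grevlex_less w)" "transp_on ?A (grevlex_less w)"
    by (metis asymp_onI grevlex_less_irrefl grevlex_less_trans)
       (metis transp_onI grevlex_less_trans)
  then obtain x where x: "x \<in> ?A" "\<forall>y\<in>?A. y \<noteq> x \<longrightarrow> \<not> grevlex_less w y x"
    using Finite_Set.bex_min_element[of ?A "grevlex_less w"] finite_monomials_of_weight[of n w, OF pos] u(2)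
    by blast
  have "standard_monomial R x"
    unfolding standard_monomial_def
  proof (clarify)
    fix a b c assume ab: "(a, b) \<in> R" and xc: "x = c + a"
    have "c + b \<in> ?A"
      using x(1) R[OF ab] by (simp add: xc keys_add_nat weight_add)
    moreover have "grevlex_less w (c + b) x"
      using R[OF ab] by (simp add: xc grevlex_less_add_left)
    ultimately show False
      using x(2) grevlex_less_irrefl by metis
  qed
  then have "x = u"
    using inj u x(1) by simp
  then show ?thesis
    using x(2) v by (cases "v = u") (auto simp: grevlex_less_irrefl)
qed

text \<open>
  The leading monomial of a nonzero element of the curve ideal is not the least of its weight, so
  by the preceding lemma it is not standard. The hypothesis \<open>inj\<close> states that \<open>x\<^sub>i \<mapsto> t\<^bsup>w i\<^esup>\<close>
  separates the standard monomials.
\<close>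

theorem binomial_groebner_basis:
  assumes pos: "\<And>i. i \<le> n \<Longrightarrow> w i > 0"
    and fin: "finite R"
    and keys: "\<And>a b. (a, b) \<in> R \<Longrightarrow> Poly_Mapping.keys a \<subseteq> {..n} \<and> Poly_Mapping.keys b \<subseteq> {..n}"
    and less: "\<And>a b. (a, b) \<in> R \<Longrightarrow> weight w a = weight w b \<and> grevlex_less w b a"
    and inj: "\<And>u v. standard_monomial R u \<Longrightarrow> standard_monomial R v \<Longrightarrow> Poly_Mapping.keys u \<subseteq> {..n} \<Longrightarrow>
      Poly_Mapping.keys v \<subseteq> {..n} \<Longrightarrow> weight w u = weight w v \<Longrightarrow> u = v"
  shows "groebner_basis n (grevlex_less w) ((\<lambda>(a, b). binomial a b) ` R)
    (curve_ideal n w :: 'a::comm_ring_1 mpoly set)"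
proof -
  let ?lt = "grevlex_less w"
  let ?G = "(\<lambda>(a, b). binomial a b) ` R :: 'a mpoly set"
  let ?P = "curve_ideal n w :: 'a mpoly set"
  interpret R: cring "mpoly_ring n :: 'a mpoly ring" by (rule cring_mpoly_ring)
  have GP: "?G \<subseteq> ?P"
    using keys less by (auto intro!: binomial_in_curve_ideal)
  have lead_closed: "lead_term ?lt f \<in> carrier (mpoly_ring n)" if "f \<in> ?P" "f \<noteq> 0" for f
    using that lead_monomial_grevlex(1)[OF \<open>f \<noteq> 0\<close>, of w]
    unfolding lead_term_def by (intro single_in_mpoly_ring) (auto simp: curve_ideal_def mpoly_ring_def)
  then have leads: "lead_term ?lt ` (?P - {0}) \<subseteq> carrier (mpoly_ring n)" by auto
  have leadsG: "lead_term ?lt ` (?G - {0}) \<subseteq> lead_term ?lt ` (?P - {0})"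
    using GP by auto
  have G_ideal: "ideal (lead_ideal n ?lt ?G) (mpoly_ring n)"
    unfolding lead_ideal_def using leads leadsG by (intro R.genideal_ideal) auto
  have "lead_term ?lt f \<in> lead_ideal n ?lt ?G" if f: "f \<in> ?P" "f \<noteq> 0" for f
  proof -
    define u where "u = lead_monomial ?lt f"
    have u: "Poly_Mapping.keys u \<subseteq> {..n}"
      using lead_monomial_grevlex(1)[OF f(2), of w] f(1) by (auto simp: u_def curve_ideal_def mpoly_ring_def)
    obtain v where "Poly_Mapping.keys v \<subseteq> {..n}" "weight w v = weight w u" "?lt v u"
      using curve_ideal_lead_monomial_not_least[OF f] unfolding u_def .
    then have "\<not> standard_monomial R u"
      using standard_monomial_least[of n w R u v] pos keys less inj u by blast
    then obtain a b c where ab: "(a, b) \<in> R" and uc: "u = c + a"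
      by (auto simp: standard_monomial_def)
    have "a \<noteq> b" using less[OF ab] grevlex_less_irrefl by metis
    have "lead_term ?lt (binomial a b) \<in> lead_ideal n ?lt ?G"
    proof -
      have "binomial a b \<in> ?G - {0}" using ab binomial_nonzero[OF \<open>a \<noteq> b\<close>, where 'a='a] by force
      then show ?thesis
        unfolding lead_ideal_def using R.genideal_self[of "lead_term ?lt ` (?G - {0})"] leads leadsG by blast
    qed
    then have "Poly_Mapping.single a 1 \<in> lead_ideal n ?lt ?G"
      using less[OF ab] by (simp add: lead_term_binomial)
    moreover have "Poly_Mapping.single c (Poly_Mapping.lookup f u) \<in> carrier (mpoly_ring n)"
      using u uc by (intro single_in_mpoly_ring) (simp add: keys_add_nat)
    ultimately have "Poly_Mapping.single c (Poly_Mapping.lookup f u) * Poly_Mapping.single a 1 \<in> lead_ideal n ?lt ?G"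
      using ideal.I_l_closed[OF G_ideal] by (simp add: mpoly_ring_def)
    then show ?thesis
      by (simp add: mult_single lead_term_def flip: u_def uc)
  qed
  then have "lead_ideal n ?lt ?P \<subseteq> lead_ideal n ?lt ?G"
    unfolding lead_ideal_def[of n ?lt ?P] by (intro R.genideal_minimal[OF G_ideal]) auto
  moreover have "lead_ideal n ?lt ?G \<subseteq> lead_ideal n ?lt ?P"
    unfolding lead_ideal_def using leads leadsG R.genideal_self[OF leads]
    by (intro R.genideal_minimal R.genideal_ideal) auto
  ultimately show ?thesis
    using GP fin ideal_curve_ideal by (auto simp: groebner_basis_def)
qed

section \<open>Arithmetic sequences\<close>

text \<open>
  The exponent vector of \<open>x\<^sub>0\<^sup>a x\<^sub>i x\<^sub>n\<^sup>b\<close>. For \<open>i = 0\<close> the middle factor is absent, so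
  that \<open>i + b n\<close> with \<open>i < n\<close> ranges over each natural number once.
\<close>

definition normal_form :: "nat \<Rightarrow> nat \<Rightarrow> nat \<Rightarrow> nat \<Rightarrow> monomial" where
  "normal_form n a i b = Poly_Mapping.single 0 a +
     Poly_Mapping.single i (if i = 0 then 0 else 1) + Poly_Mapping.single n b"

lemma weight_normal_form:
  assumes "\<And>i. i \<le> n \<Longrightarrow> w i = m0 + i * d" "i < n"
  shows "weight w (normal_form n a i b) = (a + (if i = 0 then 0 else 1) + b) * m0 + d * (i + b * n)"
  using assms(2) assms(1)[of 0] assms(1)[of i] assms(1)[of n]
  by (simp add: normal_form_def weight_add algebra_simps)

text \<open>Since \<open>d\<close> is a unit modulo \<open>m0\<close>, the weight determines the residue \<open>i + b n < m0\<close>.\<close>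

lemma normal_form_weight_inj:
  assumes w: "\<And>i. i \<le> n \<Longrightarrow> w i = m0 + i * d" and "coprime d m0"
    and i: "i < n" "i + b * n < m0" and i': "i' < n" "i' + b' * n < m0"
    and eq: "weight w (normal_form n a i b) = weight w (normal_form n a' i' b')"
  shows "normal_form n a i b = normal_form n a' i' b'"
proof -
  define s where "s j = (if j = 0 then 0 else 1 :: nat)" for j :: nat
  have eq: "(a + s i + b) * m0 + d * (i + b * n) = (a' + s i' + b') * m0 + d * (i' + b' * n)"
    using eq weight_normal_form[of n w m0 d, OF w] i i' by (simp add: s_def)
  then have "(d * (i + b * n)) mod m0 = (d * (i' + b' * n)) mod m0"
    by (metis mod_mult_self3)
  then have "[d * (i + b * n) = d * (i' + b' * n)] (mod m0)"
    by (simp add: cong_def)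
  then have "[i + b * n = i' + b' * n] (mod m0)"
    using \<open>coprime d m0\<close> cong_mult_lcancel_nat by blast
  then have k: "i + b * n = i' + b' * n"
    using i i' cong_less_modulus_unique_nat by blast
  have "i = (i + b * n) mod n" "i' = (i' + b' * n) mod n" using i i' by simp_all
  then have ii: "i = i'" using k by simp
  then have bb: "b = b'" using k i by simp
  have "(a + s i + b) * m0 = (a' + s i' + b') * m0"
    using eq k by simp
  then have "a = a'" using i ii bb by simp
  then show ?thesis using ii bb by simp
qed

text \<open>The exchange relations: their binomials are the \<open>2 \<times> 2\<close> minors \<open>x\<^sub>i x\<^sub>j - x\<^bsub>i-1\<^esub> x\<^bsub>j+1\<^esub>\<close>.\<close>

definition exchange_relations :: "nat \<Rightarrow> (monomial \<times> monomial) set" where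
  "exchange_relations n =
     {(Poly_Mapping.single i 1 + Poly_Mapping.single j 1,
       Poly_Mapping.single (i - 1) 1 + Poly_Mapping.single (j + 1) 1) | i j. 1 \<le> i \<and> i \<le> j \<and> j \<le> n - 1}"

text \<open>
  The weight of a monomial is \<open>m\<^sub>0\<close> times its degree plus \<open>d\<close> times its index sum. The index sum of
  \<open>x\<^bsub>r+j\<^esub> x\<^sub>n\<^sup>q\<close> is \<open>m\<^sub>0 + j\<close>; lowering it by \<open>m\<^sub>0\<close> is compensated by \<open>d\<close> further factors, which
  gives \<open>x\<^sub>0\<^bsup>q+d\<^esup> x\<^sub>j\<close>.
\<close>

definition wrap_relations :: "nat \<Rightarrow> nat \<Rightarrow> nat \<Rightarrow> nat \<Rightarrow> (monomial \<times> monomial) set" where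
  "wrap_relations n d q r =
     {(Poly_Mapping.single (r + j) 1 + Poly_Mapping.single n q,
       Poly_Mapping.single 0 (q + d) + Poly_Mapping.single j 1) | j. j \<le> n - r}"

lemma standard_monomial_Un:
  "standard_monomial (R \<union> S) u \<longleftrightarrow> standard_monomial R u \<and> standard_monomial S u"
  by (auto simp: standard_monomial_def)

text \<open>
  The exchange relations forbid two middle variables, counted with multiplicity. The wrap-around
  relations bound the exponent \<open>b\<close> of \<open>x\<^sub>n\<close> by \<open>q\<close> and, when it equals \<open>q\<close>, the middle index by
  \<open>i < r\<close>; together this is \<open>i + b n < q n + r\<close>.
\<close>

lemma standard_monomial_shape:
  assumes "n > 0" "1 \<le> r" "r \<le> n"
    and std: "standard_monomial (exchange_relations n \<union> wrap_relations n d q r) u"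
    and keys: "Poly_Mapping.keys u \<subseteq> {..n}"
  obtains a i b where "i < n" "i + b * n < q * n + r" "u = normal_form n a i b"
proof -
  let ?u = "Poly_Mapping.lookup u"
  have exch: "\<not> (\<forall>k. Poly_Mapping.lookup (Poly_Mapping.single i 1 + Poly_Mapping.single j 1) k \<le> ?u k)"
    if "1 \<le> i" "i \<le> j" "j < n" for i j
    using std that unfolding standard_monomial_Un
    by (fastforce simp: standard_monomial_def exchange_relations_def simp flip: monomial_divides_iff)
  have wrap: "\<not> (\<forall>k. Poly_Mapping.lookup (Poly_Mapping.single i 1 + Poly_Mapping.single n q) k \<le> ?u k)"
    if "r \<le> i" "i \<le> n" for i
  proof -
    have "i = r + (i - r)" "i - r \<le> n - r" using that by auto
    then have "\<exists>b. (Poly_Mapping.single i 1 + Poly_Mapping.single n q, b) \<in> wrap_relations n d q r"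
      unfolding wrap_relations_def by (auto intro: exI[of _ "i - r"])
    then show ?thesis
      using std unfolding standard_monomial_Un
      by (fastforce simp: standard_monomial_def simp flip: monomial_divides_iff)
  qed
  have out: "?u k = 0" if "k > n" for k
    using keys that by (force simp: in_keys_iff)
  have "\<exists>i<n. (i = 0 \<or> ?u i = 1) \<and> (\<forall>k. 0 < k \<and> k < n \<and> k \<noteq> i \<longrightarrow> ?u k = 0)"
  proof (cases "\<forall>k. 0 < k \<and> k < n \<longrightarrow> ?u k = 0")
    case True
    then show ?thesis using \<open>n > 0\<close> by blast
  next
    case False
    then obtain i where i: "0 < i" "i < n" "?u i > 0" by auto
    have "?u k = 0" if "0 < k" "k < n" "k \<noteq> i" for k
    proof (rule ccontr)
      assume "?u k \<noteq> 0"
      then show False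
        using exch[of i k] exch[of k i] that i
        by (cases "i < k") (auto simp: lookup_add lookup_single when_def split: if_splits)
    qed
    moreover have "?u i = 1"
    proof (rule ccontr)
      assume "?u i \<noteq> 1"
      then show False
        using exch[of i i] i by (auto simp: lookup_add lookup_single when_def split: if_splits)
    qed
    ultimately show ?thesis using i by blast
  qed
  then obtain i where i: "i < n" "i = 0 \<or> ?u i = 1" "\<And>k. 0 < k \<Longrightarrow> k < n \<Longrightarrow> k \<noteq> i \<Longrightarrow> ?u k = 0"
    by blast
  have form: "u = normal_form n (?u 0) i (?u n)"
  proof (rule poly_mapping_eqI)
    fix k
    consider "k = 0" | "k = n" | "k > n" | "0 < k" "k < n" "k = i" | "0 < k" "k < n" "k \<noteq> i"
      by linarith
    then show "?u k = Poly_Mapping.lookup (normal_form n (?u 0) i (?u n)) k"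
      using i out[of k] \<open>n > 0\<close>
      by cases (auto simp: normal_form_def lookup_add lookup_single when_def)
  qed
  have le: "?u n \<le> q"
    using wrap[of n] \<open>r \<le> n\<close> by (auto simp: lookup_add lookup_single when_def split: if_splits)
  have lt: "i < r" if "?u n = q"
    using wrap[of i] i that \<open>1 \<le> r\<close>
    by (cases "i < r") (auto simp: lookup_add lookup_single when_def split: if_splits)
  have "i + ?u n * n < q * n + r"
  proof (cases "?u n = q")
    case True
    then show ?thesis using lt by simp
  next
    case False
    then have "Suc (?u n) * n \<le> q * n" using le by (intro mult_right_mono) auto
    then show ?thesis using i(1) by simp
  qed
  then show ?thesis using that i(1) form by blast
qed

lemma exchange_relation_less:
  assumes w: "\<And>i. i \<le> n \<Longrightarrow> w i = m0 + i * d" and "n > 0" and ab: "(a, b) \<in> exchange_relations n"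
  shows "Poly_Mapping.keys a \<subseteq> {..n}" "Poly_Mapping.keys b \<subseteq> {..n}"
    "weight w a = weight w b" "grevlex_less w b a"
proof -
  obtain i j where a: "a = Poly_Mapping.single i 1 + Poly_Mapping.single j 1"
    and b: "b = Poly_Mapping.single (i - 1) 1 + Poly_Mapping.single (j + 1) 1"
    and ij: "1 \<le> i" "i \<le> j" "j \<le> n - 1"
    using ab by (auto simp: exchange_relations_def)
  show "Poly_Mapping.keys a \<subseteq> {..n}" "Poly_Mapping.keys b \<subseteq> {..n}"
    using ij \<open>n > 0\<close> by (auto simp: a b keys_add_nat)
  obtain i' where i': "i = Suc i'" using ij by (cases i) auto
  show weight: "weight w a = weight w b"
    using ij \<open>n > 0\<close> w[of i] w[of j] w[of "i - 1"] w[of "j + 1"] by (simp add: a b weight_add i')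
  show "grevlex_less w b a"
    unfolding grevlex_less_def
    by (rule disjI2, intro conjI exI[of _ "i - 1"])
       (use weight ij in \<open>auto simp: a b lookup_add lookup_single when_def\<close>)
qed

lemma wrap_relation_less:
  assumes w: "\<And>i. i \<le> n \<Longrightarrow> w i = m0 + i * d" and "n > 0" "d > 0" and m0: "m0 = q * n + r"
    and r: "1 \<le> r" "r \<le> n" and ab: "(a, b) \<in> wrap_relations n d q r"
  shows "Poly_Mapping.keys a \<subseteq> {..n}" "Poly_Mapping.keys b \<subseteq> {..n}"
    "weight w a = weight w b" "grevlex_less w b a"
proof -
  obtain j where a: "a = Poly_Mapping.single (r + j) 1 + Poly_Mapping.single n q"
    and b: "b = Poly_Mapping.single 0 (q + d) + Poly_Mapping.single j 1" and j: "j \<le> n - r"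
    using ab by (auto simp: wrap_relations_def)
  show "Poly_Mapping.keys a \<subseteq> {..n}" "Poly_Mapping.keys b \<subseteq> {..n}"
    using j r by (auto simp: a b keys_add_nat)
  have "(m0 + (r + j) * d) + q * (m0 + n * d) = (q * n + r) * d + q * m0 + (m0 + j * d)"
    by (simp add: algebra_simps)
  also have "\<dots> = (q + d) * m0 + (m0 + j * d)"
    unfolding m0[symmetric] by (simp add: algebra_simps)
  finally show weight: "weight w a = weight w b"
    using j r w[of "r + j"] w[of n] w[of 0] w[of j] by (simp add: a b weight_add)
  show "grevlex_less w b a"
    unfolding grevlex_less_def
    by (rule disjI2, intro conjI exI[of _ 0])
       (use weight r \<open>n > 0\<close> \<open>d > 0\<close> in \<open>auto simp: a b lookup_add lookup_single when_def\<close>)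
qed

lemma finite_relations: "finite (exchange_relations n \<union> wrap_relations n d q r)"
proof -
  have "exchange_relations n \<subseteq> (\<lambda>(i, j). (Poly_Mapping.single i 1 + Poly_Mapping.single j 1,
       Poly_Mapping.single (i - 1) 1 + Poly_Mapping.single (j + 1) 1)) ` ({..n} \<times> {..n})"
    by (force simp: exchange_relations_def)
  then have "finite (exchange_relations n)" by (rule finite_subset) simp
  then show ?thesis by (simp add: wrap_relations_def)
qed

theorem proposition8:
  fixes n d q r :: nat and m :: "nat \<Rightarrow> nat"
  assumes "n \<ge> 2"
    and "m 0 > 0" and "d > 0" and "gcd (m 0) d = 1"
    and "\<And>i. i \<le> n \<Longrightarrow> m i = m 0 + i * d"
    and "Gcd (m ` {..n}) = 1"
    and "minimally_generates n m"
    and "m 0 = q * n + r" and "1 \<le> r" and "r \<le> n"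
  shows "groebner_basis n (grevlex_less m)
           ({Var i * Var j - Var (i - 1) * Var (j + 1) | i j. 1 \<le> i \<and> i \<le> j \<and> j \<le> n - 1} \<union>
            {Var (r + j) * Var n ^ q - Var 0 ^ (q + d) * Var j | j. j \<le> n - r})
           (curve_ideal n m :: 'a::field mpoly set)"
proof -
  let ?R = "exchange_relations n \<union> wrap_relations n d q r"
  note m = assms(5)
  have "n > 0" using assms(1) by simp
  have cop: "coprime d (m 0)"
    using assms(4) by (simp add: coprime_iff_gcd_eq_1 gcd.commute)
  have "groebner_basis n (grevlex_less m) ((\<lambda>(a, b). binomial a b) ` ?R) (curve_ideal n m :: 'a mpoly set)"
  proof (rule binomial_groebner_basis)
    show "m i > 0" if "i \<le> n" for i using m[OF that] assms(2) by simp
    show "finite ?R" by (rule finite_relations)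
  next
    fix a b assume "(a, b) \<in> ?R"
    then show "Poly_Mapping.keys a \<subseteq> {..n} \<and> Poly_Mapping.keys b \<subseteq> {..n}"
      and "weight m a = weight m b \<and> grevlex_less m b a"
      using exchange_relation_less[of n m "m 0" d a b, OF m \<open>n > 0\<close>]
        wrap_relation_less[of n m "m 0" d q r a b, OF m \<open>n > 0\<close> \<open>d > 0\<close> assms(8-10)] by blast+
  next
    fix u v assume std: "standard_monomial ?R u" "standard_monomial ?R v"
      and keys: "Poly_Mapping.keys u \<subseteq> {..n}" "Poly_Mapping.keys v \<subseteq> {..n}"
      and eq: "weight m u = weight m v"
    obtain a i b where "i < n" "i + b * n < m 0" "u = normal_form n a i b"
      using standard_monomial_shape[OF \<open>n > 0\<close> assms(9,10) std(1) keys(1)] assms(8) by metis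
    moreover obtain a' i' b' where "i' < n" "i' + b' * n < m 0" "v = normal_form n a' i' b'"
      using standard_monomial_shape[OF \<open>n > 0\<close> assms(9,10) std(2) keys(2)] assms(8) by metis
    ultimately show "u = v"
      using normal_form_weight_inj[of n m "m 0" d, OF m cop] eq by blast
  qed
  moreover have "(\<lambda>(a, b). binomial a b) ` exchange_relations n =
      {Var i * Var j - Var (i - 1) * Var (j + 1) :: 'a mpoly | i j. 1 \<le> i \<and> i \<le> j \<and> j \<le> n - 1}"
    by (force simp: exchange_relations_def image_iff binomial_def Var_def mult_single)
  moreover have "(\<lambda>(a, b). binomial a b) ` wrap_relations n d q r =
      {Var (r + j) * Var n ^ q - Var 0 ^ (q + d) * Var j :: 'a mpoly | j. j \<le> n - r}"
    unfolding Var_power by (force simp: wrap_relations_def image_iff binomial_def Var_def mult_single)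
  ultimately show ?thesis
    by (simp only: image_Un)
qed

end
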